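(* Let $k$ be a field, $A$ a commutative $k$-algebra, $\Xi:A\to A$ a $k$-linear map, and $\Psi$ the associated invariant. Then $\Psi$ distinguishes rooted trees (i.e. for all rooted trees $T_1,T_2$, $\Psi(T_1)=\Psi(T_2)$ if and only if $T_1\cong T_2$) if and only if $\Psi$ is finer than $\alpha$, i.e. for all rooted trees $T_1,T_2$, $\alpha(T_1)\neq\alpha(T_2)$ implies $\Psi(T_1)\ne\Psi(T_2)$.
   Context: A rooted tree is a finite connected acyclic graph with a distinguished vertex (its root); isomorphisms are root-preserving. $\alpha(T)$ is the order of the group of root-preserving automorphisms of $T$. In a rooted tree, a vertex $w$ is a child of $v$ if $v,w$ are joined by an edge and $w$ is farther from the root than $v$; a leaf is a vertex without children. The invariant $\Psi$ is defined as follows. For a rooted tree $T$, assign to each vertex $v$ an element $N_v\in A$ inductively starting from the vertices farthest from the root: if $v$ is a leaf, $N_v=\Xi(1)$; otherwise $N_v=\Xi(N_{v_1}\cdots N_{v_k})$ where $v_1,\dots,v_k$ are the distinct children of $v$. Set $\Psi(T)=N_{\mathrm{rt}_T}$. *)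

theory Defs
  imports
    "Graph_Theory.Digraph_Component"
    "HOL-Algebra.Module"
    "HOL-Algebra.Bij"
    "HOL-Algebra.Coset"
    "HOL-Library.Infinite_Typeclass"
begin

record 'v rooted_graph =
  rt_graph :: "'v pair_pre_digraph"
  rt_root :: 'v

text \<open>
  A simple graph is a finite loop-free symmetric set of arcs. An undirected edge
  is thus a pair of opposite arcs, which form a closed walk of length 2; the cycles
  of the undirected graph are the ones of length at least 3. (For this reason the
  library's \<^const>\<open>forest\<close> and \<^const>\<open>tree\<close>, which exclude all directed cycles,
  are not the right notions for symmetric graphs.)

  Vertices are drawn from an arbitrary type. Over an infinite vertex type every finite
  rooted tree occurs up to isomorphism.
\<close>

definition acyclic_graph :: "'v pair_pre_digraph \<Rightarrow> bool" where
  "acyclic_graph G \<longleftrightarrow> \<not> (\<exists>p. pre_digraph.cycle (with_proj G) p \<and> 3 \<le> length p)"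

definition rooted_tree :: "'v rooted_graph \<Rightarrow> bool" where
  "rooted_tree T \<longleftrightarrow>
     pair_graph (rt_graph T) \<and> Digraph_Component.connected (with_proj (rt_graph T)) \<and>
     acyclic_graph (rt_graph T) \<and> rt_root T \<in> pverts (rt_graph T)"

definition rooted_iso :: "'v rooted_graph \<Rightarrow> 'w rooted_graph \<Rightarrow> ('v \<Rightarrow> 'w) \<Rightarrow> bool" where
  "rooted_iso S T f \<longleftrightarrow>
     bij_betw f (pverts (rt_graph S)) (pverts (rt_graph T)) \<and>
     (\<forall>u\<in>pverts (rt_graph S). \<forall>v\<in>pverts (rt_graph S).
        (u, v) \<in> parcs (rt_graph S) \<longleftrightarrow> (f u, f v) \<in> parcs (rt_graph T)) \<and>
     f (rt_root S) = rt_root T"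

definition rooted_isomorphic :: "'v rooted_graph \<Rightarrow> 'w rooted_graph \<Rightarrow> bool" where
  "rooted_isomorphic S T \<longleftrightarrow> (\<exists>f. rooted_iso S T f)"

definition rooted_Aut :: "'v rooted_graph \<Rightarrow> ('v \<Rightarrow> 'v) monoid" where
  "rooted_Aut T =
     (BijGroup (pverts (rt_graph T)))
       \<lparr>carrier := {f \<in> Bij (pverts (rt_graph T)). rooted_iso T T f}\<rparr>"

definition aut_order :: "'v rooted_graph \<Rightarrow> nat" where
  "aut_order T = order (rooted_Aut T)"

definition graph_dist :: "'v pair_pre_digraph \<Rightarrow> 'v \<Rightarrow> 'v \<Rightarrow> nat" where
  "graph_dist G u v = (LEAST n. \<exists>p. pre_digraph.awalk (with_proj G) u p v \<and> length p = n)"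

definition children :: "'v rooted_graph \<Rightarrow> 'v \<Rightarrow> 'v set" where
  "children T v =
     {w. (v, w) \<in> parcs (rt_graph T) \<and>
         graph_dist (rt_graph T) (rt_root T) v < graph_dist (rt_graph T) (rt_root T) w}"

definition leaf :: "'v rooted_graph \<Rightarrow> 'v \<Rightarrow> bool" where
  "leaf T v \<longleftrightarrow> children T v = {}"

lemma foldSetD_mono_cong:
  assumes "(C, y) \<in> foldSetD D f e" and "\<And>x. x \<in> C \<Longrightarrow> f x = g x"
  shows "(C, y) \<in> foldSetD D g e"
  using assms
proof (induction rule: foldSetD.induct)
  case emptyI
  then show ?case by (auto intro: foldSetD.intros)
next
  case (insertI x C y)
  then have "(C, y) \<in> foldSetD D g e" and fg: "f x = g x" by auto
  then show ?case
    using insertI.hyps foldSetD.insertI[of x C g y D e] by simp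
qed

lemma finprod_fundef_cong [fundef_cong]:
  assumes "G = H" and "S = S'" and "\<And>x. x \<in> S' \<Longrightarrow> f x = g x"
  shows "finprod G f S = finprod H g S'"
proof -
  have "(S', y) \<in> foldSetD (carrier H) (mult H \<circ> f) \<one>\<^bsub>H\<^esub> \<longleftrightarrow>
        (S', y) \<in> foldSetD (carrier H) (mult H \<circ> g) \<one>\<^bsub>H\<^esub>" for y
    by (auto intro: foldSetD_mono_cong simp: assms(3))
  then show ?thesis
    by (simp add: assms(1,2) finprod_def foldD_def)
qed

text \<open>
  The recursion descends from a vertex to its children, so it is well founded only on
  finite graphs; the value is left unspecified on anything that is not a rooted tree.
\<close>

function node_value ::
  "('a, 'm) monoid_scheme \<Rightarrow> ('a \<Rightarrow> 'a) \<Rightarrow> 'v rooted_graph \<Rightarrow> 'v \<Rightarrow> 'a" where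
  "node_value A \<Xi> T v =
     (if \<not> rooted_tree T then undefined
      else if leaf T v then \<Xi> \<one>\<^bsub>A\<^esub>
      else \<Xi> (finprod A (\<lambda>w. node_value A \<Xi> T w) (children T v)))"
  by pat_completeness auto
termination
proof (relation "measure (\<lambda>(A, \<Xi>, T, v).
    card {u \<in> pverts (rt_graph T).
            graph_dist (rt_graph T) (rt_root T) v < graph_dist (rt_graph T) (rt_root T) u})",
    goal_cases)
  case (2 A \<Xi> T v w)
  let ?d = "graph_dist (rt_graph T) (rt_root T)"
  let ?above = "\<lambda>x. {u \<in> pverts (rt_graph T). ?d x < ?d u}"
  have g: "pair_graph (rt_graph T)"
    using 2 by (simp add: rooted_tree_def)
  then have fin: "finite (pverts (rt_graph T))"
    by (simp add: pair_graph_def pair_digraph_def pair_fin_digraph.pair_finite_verts)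
  have arc: "(v, w) \<in> parcs (rt_graph T)" and less: "?d v < ?d w"
    using 2 by (auto simp: children_def)
  have "w \<in> pverts (rt_graph T)"
    using g arc pair_wf_digraph.arc_snd_in_verts[of "rt_graph T" "(v, w)"]
    by (simp add: pair_graph_def pair_digraph_def pair_fin_digraph_def)
  with less have "w \<in> ?above v - ?above w" and "?above w \<subseteq> ?above v"
    by auto
  then have "?above w \<subset> ?above v" by blast
  then have "card (?above w) < card (?above v)"
    using fin by (intro psubset_card_mono) auto
  then show ?case by simp
qed simp

declare node_value.simps [simp del]

definition tree_invariant ::
  "('a, 'm) monoid_scheme \<Rightarrow> ('a \<Rightarrow> 'a) \<Rightarrow> 'v rooted_graph \<Rightarrow> 'a" where
  "tree_invariant A \<Xi> T = node_value A \<Xi> T (rt_root T)"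

definition linear_endo ::
  "('k, 'm) ring_scheme \<Rightarrow> ('k, 'a, 'n) module_scheme \<Rightarrow> ('a \<Rightarrow> 'a) \<Rightarrow> bool" where
  "linear_endo K A \<Xi> \<longleftrightarrow>
     (\<forall>x\<in>carrier A. \<Xi> x \<in> carrier A) \<and>
     (\<forall>x\<in>carrier A. \<forall>y\<in>carrier A. \<Xi> (x \<oplus>\<^bsub>A\<^esub> y) = \<Xi> x \<oplus>\<^bsub>A\<^esub> \<Xi> y) \<and>
     (\<forall>c\<in>carrier K. \<forall>x\<in>carrier A. \<Xi> (c \<odot>\<^bsub>A\<^esub> x) = c \<odot>\<^bsub>A\<^esub> \<Xi> x)"

lemma subgroup_rooted_Aut:
  assumes "rt_root T \<in> pverts (rt_graph T)"
  shows "subgroup (carrier (rooted_Aut T)) (BijGroup (pverts (rt_graph T)))"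
proof -
  let ?V = "pverts (rt_graph T)"
  interpret B: group "BijGroup ?V" by (rule group_BijGroup)
  have iv: "inv\<^bsub>BijGroup ?V\<^esub> f = restrict (inv_into ?V f) ?V" if "f \<in> Bij ?V" for f
    using that by (rule inv_BijGroup)
  show ?thesis
  proof (rule B.subgroupI)
    show "carrier (rooted_Aut T) \<subseteq> carrier (BijGroup ?V)"
      by (auto simp: rooted_Aut_def BijGroup_def)
    have "(\<lambda>x\<in>?V. x) \<in> carrier (rooted_Aut T)"
      using assms id_Bij[of ?V]
      by (auto simp: rooted_Aut_def rooted_iso_def Bij_def)
    then show "carrier (rooted_Aut T) \<noteq> {}" by blast
  next
    fix f assume "f \<in> carrier (rooted_Aut T)"
    then have f: "f \<in> Bij ?V" "rooted_iso T T f" by (auto simp: rooted_Aut_def)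
    have b: "bij_betw f ?V ?V" using f by (simp add: Bij_def)
    have g: "restrict (inv_into ?V f) ?V \<in> Bij ?V"
      using restrict_inv_into_Bij[OF f(1)] by simp
    have "rooted_iso T T (restrict (inv_into ?V f) ?V)"
      unfolding rooted_iso_def
    proof (intro conjI ballI)
      show "bij_betw (restrict (inv_into ?V f) ?V) ?V ?V" using g by (simp add: Bij_def)
      have "inv_into ?V f (rt_root T) = rt_root T"
        using b f(2) assms by (metis bij_betw_inv_into_left rooted_iso_def)
      then show "restrict (inv_into ?V f) ?V (rt_root T) = rt_root T"
        using assms by simp
      fix u v assume uv: "u \<in> ?V" "v \<in> ?V"
      have "inv_into ?V f u \<in> ?V" "inv_into ?V f v \<in> ?V"
        "f (inv_into ?V f u) = u" "f (inv_into ?V f v) = v"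
        using uv b f(1) by (auto simp: Bij_inv_into_mem bij_betw_inv_into_right)
      then show "(u, v) \<in> parcs (rt_graph T) \<longleftrightarrow>
          (restrict (inv_into ?V f) ?V u, restrict (inv_into ?V f) ?V v) \<in> parcs (rt_graph T)"
        using f(2) uv unfolding rooted_iso_def by (metis restrict_apply')
    qed
    then show "inv\<^bsub>BijGroup ?V\<^esub> f \<in> carrier (rooted_Aut T)"
      using g f(1) by (simp add: iv rooted_Aut_def)
  next
    fix f g assume "f \<in> carrier (rooted_Aut T)" "g \<in> carrier (rooted_Aut T)"
    then have f: "f \<in> Bij ?V" "rooted_iso T T f" and g: "g \<in> Bij ?V" "rooted_iso T T g"
      by (auto simp: rooted_Aut_def)
    have "compose ?V f g \<in> Bij ?V" using f g by (simp add: compose_Bij)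
    moreover have "rooted_iso T T (compose ?V f g)"
      using calculation f(2) g(2) assms Bij_imp_funcset[OF g(1)]
      by (auto simp: rooted_iso_def Bij_def compose_def Pi_iff)
    ultimately show "f \<otimes>\<^bsub>BijGroup ?V\<^esub> g \<in> carrier (rooted_Aut T)"
      using f(1) g(1) by (simp add: rooted_Aut_def BijGroup_def)
  qed
qed

lemma group_rooted_Aut:
  assumes "rooted_tree T"
  shows "group (rooted_Aut T)"
proof -
  have "rt_root T \<in> pverts (rt_graph T)"
    using assms by (simp add: rooted_tree_def)
  then have "subgroup (carrier (rooted_Aut T)) (BijGroup (pverts (rt_graph T)))"
    by (rule subgroup_rooted_Aut)
  then have "group ((BijGroup (pverts (rt_graph T)))\<lparr>carrier := carrier (rooted_Aut T)\<rparr>)"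
    by (rule subgroup.subgroup_is_group[OF _ group_BijGroup])
  then show ?thesis by (simp add: rooted_Aut_def)
qed

end

theory Submission
  imports Defs
begin

text \<open>
  Write \<open>[S, T]\<close> for the tree obtained by joining the roots of \<open>S\<close> and \<open>T\<close> to a new root,
  so that \<open>\<Psi>[S, T] = \<Xi> (\<Psi> S \<cdot> \<Psi> T)\<close>. If \<open>\<Psi> S = \<Psi> T\<close> then also \<open>\<Psi>[S, S] = \<Psi>[S, T]\<close>, and
  \<open>\<alpha> S = \<alpha> T\<close> when \<open>\<Psi>\<close> is finer than \<open>\<alpha>\<close>. Every automorphism of \<open>[S, T]\<close> permutes the two
  branches, and those that fix both branches number \<open>\<alpha> S \<cdot> \<alpha> T\<close>. If \<open>S\<close> and \<open>T\<close> are not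
  isomorphic there are no others, whereas \<open>[S, S]\<close> admits a swap; hence
  \<open>\<alpha>[S, T] = (\<alpha> S)\<^sup>2 < \<alpha>[S, S]\<close>, a contradiction.
\<close>

abbreviation tverts :: "'v rooted_graph \<Rightarrow> 'v set" where
  "tverts T \<equiv> pverts (rt_graph T)"

abbreviation tarcs :: "'v rooted_graph \<Rightarrow> ('v \<times> 'v) set" where
  "tarcs T \<equiv> parcs (rt_graph T)"

section \<open>Walks and rooted trees\<close>

lemma awalk_with_proj_iff:
  "pre_digraph.awalk (with_proj G) u p v \<longleftrightarrow> u \<in> pverts G \<and> set p \<subseteq> parcs G \<and> pcas u p v"
  by (simp add: pre_digraph.awalk_def cas_with_proj_eq)

lemma pcas_append:
  "pcas u (p @ q) w \<longleftrightarrow> (\<exists>v. pcas u p v \<and> pcas v q w)"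
  by (induction p arbitrary: u) auto

lemma pcas_map:
  "pcas u p v \<Longrightarrow> pcas (f u) (map (map_prod f f) p) (f v)"
  by (induction p arbitrary: u) auto

lemma pcas_last_in_heads:
  "pcas u p v \<Longrightarrow> p \<noteq> [] \<Longrightarrow> v \<in> snd ` set p"
  by (induction p arbitrary: u) (auto, (metis pcas.simps(1))+)

text \<open>The library asks that the tail of a cycle's vertex list be distinct. On a walk this tail
  is the list of heads of the arcs, so cycles become closed walks with distinct heads, a condition
  that is easy to rotate and to transport.\<close>

lemma tl_pawalk_verts:
  "pcas u p v \<Longrightarrow> tl (pawalk_verts u p) = map snd p"
proof (induction p arbitrary: u)
  case (Cons e p)
  have "pawalk_verts (snd e) p = snd e # tl (pawalk_verts (snd e) p)"
    using Cons.prems by (cases p) auto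
  with Cons show ?case by simp
qed simp

lemma cycle_with_proj_iff:
  "pre_digraph.cycle (with_proj G) p \<longleftrightarrow>
     p \<noteq> [] \<and> (\<exists>u\<in>pverts G. set p \<subseteq> parcs G \<and> pcas u p u \<and> distinct (map snd p))"
  by (auto simp: pre_digraph.cycle_def awalk_with_proj_iff awalk_verts_with_proj_eq
      tl_pawalk_verts simp del: distinct_map)

lemma graph_dist_eq:
  "graph_dist G u v =
     (LEAST n. \<exists>p. u \<in> pverts G \<and> set p \<subseteq> parcs G \<and> pcas u p v \<and> length p = n)"
  by (simp add: graph_dist_def awalk_with_proj_iff conj_assoc)

text \<open>Arcs are symmetric, so \<open>mk_symmetric\<close> changes nothing and reachability is a
  symmetric relation; any two vertices are then linked through \<open>r\<close>.\<close>

lemma connected_iff_root: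
  assumes "pair_graph G" and "r \<in> pverts G"
  shows "Digraph_Component.connected (with_proj G) \<longleftrightarrow> (\<forall>v\<in>pverts G. (r, v) \<in> (parcs G)\<^sup>*)"
proof -
  interpret pair_graph G by fact
  have s: "sym (parcs G)"
    using sym_arcs by (simp add: symmetric_def)
  have eq: "mk_symmetric (with_proj G) = G"
    using s by (cases G) (auto simp: mk_symmetric_def dest: symD)
  have "sym ((parcs G)\<^sup>*)"
    using s by (rule sym_rtrancl)
  then have "(u, v) \<in> (parcs G)\<^sup>*"
    if "\<forall>v\<in>pverts G. (r, v) \<in> (parcs G)\<^sup>*" "u \<in> pverts G" "v \<in> pverts G" for u v
    using that by (meson rtrancl_trans symD)
  then show ?thesis
    using assms(2)
    by (auto simp: Digraph_Component.connected_def eq strongly_connected_def reachable_conv)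
qed

text \<open>The working form of the definition, in terms of sets and lists of arcs. The cycle
  condition can range over all \<open>u\<close>: the base of a nonempty closed walk is the head of
  one of its arcs, hence a vertex, and the empty walk has length below 3.\<close>

lemma rooted_tree_iff:
  "rooted_tree T \<longleftrightarrow>
     finite (tverts T) \<and> tarcs T \<subseteq> tverts T \<times> tverts T \<and> sym (tarcs T) \<and> irrefl (tarcs T) \<and>
     rt_root T \<in> tverts T \<and> (\<forall>v\<in>tverts T. (rt_root T, v) \<in> (tarcs T)\<^sup>*) \<and>
     (\<forall>u p. set p \<subseteq> tarcs T \<longrightarrow> pcas u p u \<longrightarrow> distinct (map snd p) \<longrightarrow> length p < 3)"
proof -
  let ?G = "rt_graph T"
  have g: "pair_graph ?G \<longleftrightarrow>
      finite (tverts T) \<and> tarcs T \<subseteq> tverts T \<times> tverts T \<and> sym (tarcs T) \<and> irrefl (tarcs T)"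
    (is "_ \<longleftrightarrow> ?R")
  proof
    assume "pair_graph ?G"
    then interpret pair_graph ?G .
    show ?R
      using finite_verts sym_arcs no_loops'
      by (auto simp: symmetric_def irrefl_def dest: in_arcsD1 in_arcsD2)
  next
    assume R: ?R
    then have "finite (tarcs T)"
      by (meson finite_SigmaI finite_subset)
    with R show "pair_graph ?G"
      by unfold_locales (auto simp: symmetric_def irrefl_def)
  qed
  have c: "acyclic_graph ?G \<longleftrightarrow>
      (\<forall>u p. set p \<subseteq> tarcs T \<longrightarrow> pcas u p u \<longrightarrow> distinct (map snd p) \<longrightarrow> length p < 3)"
    if "tarcs T \<subseteq> tverts T \<times> tverts T"
  proof -
    have "u \<in> tverts T" if "set p \<subseteq> tarcs T" "pcas u p u" "p \<noteq> []" for u p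
      using pcas_last_in_heads[OF that(2,3)] that(1) \<open>tarcs T \<subseteq> _\<close> by auto
    then show ?thesis
      unfolding acyclic_graph_def cycle_with_proj_iff by (force simp: not_le)
  qed
  show ?thesis
    unfolding rooted_tree_def using g c connected_iff_root[of ?G "rt_root T"] by blast
qed

lemma
  assumes "rooted_tree T"
  shows rooted_tree_finite: "finite (tverts T)"
    and rooted_tree_arcs: "(u, v) \<in> tarcs T \<Longrightarrow> u \<in> tverts T \<and> v \<in> tverts T"
    and rooted_tree_sym: "(u, v) \<in> tarcs T \<Longrightarrow> (v, u) \<in> tarcs T"
    and rooted_tree_root: "rt_root T \<in> tverts T"
    and rooted_tree_reach: "v \<in> tverts T \<Longrightarrow> (rt_root T, v) \<in> (tarcs T)\<^sup>*"
  using assms by (auto simp: rooted_tree_iff dest: symD)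

section \<open>Isomorphisms\<close>

lemma rooted_iso_arc_iff:
  assumes "rooted_iso S T f" and "u \<in> tverts S" and "v \<in> tverts S"
  shows "(f u, f v) \<in> tarcs T \<longleftrightarrow> (u, v) \<in> tarcs S"
  using assms by (auto simp: rooted_iso_def)

lemma rooted_iso_inv_into:
  assumes "rooted_iso S T f" and "rt_root S \<in> tverts S"
  shows "rooted_iso T S (inv_into (tverts S) f)"
proof -
  let ?g = "inv_into (tverts S) f"
  have b: "bij_betw f (tverts S) (tverts T)"
    using assms by (simp add: rooted_iso_def)
  have g: "?g y \<in> tverts S" "f (?g y) = y" if "y \<in> tverts T" for y
    using b that by (auto simp: bij_betw_inv_into_right bij_betw_def inv_into_into)
  have "?g (rt_root T) = rt_root S"
    using assms b by (metis bij_betw_inv_into_left rooted_iso_def)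
  then show ?thesis
    using assms(1) g bij_betw_inv_into[OF b] unfolding rooted_iso_def by auto
qed

lemma rooted_iso_comp:
  assumes "rooted_iso S T f" and "rooted_iso T U g"
  shows "rooted_iso S U (g \<circ> f)"
proof -
  have "f u \<in> tverts T" if "u \<in> tverts S" for u
    using assms(1) that by (auto simp: rooted_iso_def bij_betw_def)
  then show ?thesis
    using assms bij_betw_trans[of f "tverts S" "tverts T" g "tverts U"]
    unfolding rooted_iso_def by simp
qed

lemma rooted_iso_cong:
  assumes "rooted_iso S T f" and "\<And>x. x \<in> tverts S \<Longrightarrow> g x = f x" and "rt_root S \<in> tverts S"
  shows "rooted_iso S T g"
  using assms bij_betw_cong[of "tverts S" g f "tverts T"] unfolding rooted_iso_def by auto

lemma rooted_isomorphic_sym: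
  assumes "rooted_isomorphic S T" and "rt_root S \<in> tverts S"
  shows "rooted_isomorphic T S"
  using assms rooted_iso_inv_into unfolding rooted_isomorphic_def by blast

lemma rooted_isomorphic_trans:
  assumes "rooted_isomorphic S T" and "rooted_isomorphic T U"
  shows "rooted_isomorphic S U"
  using assms rooted_iso_comp unfolding rooted_isomorphic_def by blast

lemma rooted_iso_walk:
  assumes "rooted_iso S T f" and "rooted_tree S"
    and "u \<in> tverts S" and "set p \<subseteq> tarcs S" and "pcas u p v"
  shows "f u \<in> tverts T" and "set (map (map_prod f f) p) \<subseteq> tarcs T"
    and "pcas (f u) (map (map_prod f f) p) (f v)"
proof -
  show "f u \<in> tverts T"
    using assms(1,3) by (auto simp: rooted_iso_def bij_betw_def)
  show "set (map (map_prod f f) p) \<subseteq> tarcs T"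
    using assms(1,4) rooted_tree_arcs[OF assms(2)] unfolding rooted_iso_def by fastforce
  show "pcas (f u) (map (map_prod f f) p) (f v)"
    using assms(5) by (rule pcas_map)
qed

section \<open>Isomorphisms preserve distances, children and the invariant\<close>

text \<open>Walks are carried over by \<open>f\<close> and back by its inverse without change of
  length, so both minima are taken over the same set of lengths.\<close>

lemma rooted_iso_graph_dist:
  assumes f: "rooted_iso S T f" and S: "rooted_tree S" and T: "rooted_tree T"
    and u: "u \<in> tverts S" and v: "v \<in> tverts S"
  shows "graph_dist (rt_graph T) (f u) (f v) = graph_dist (rt_graph S) u v"
proof -
  let ?g = "inv_into (tverts S) f"
  have g: "rooted_iso T S ?g"
    using f rooted_tree_root[OF S] by (rule rooted_iso_inv_into)
  have gf: "?g (f x) = x" if "x \<in> tverts S" for x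
    using f that by (metis bij_betw_inv_into_left rooted_iso_def)
  have "(\<exists>p. f u \<in> tverts T \<and> set p \<subseteq> tarcs T \<and> pcas (f u) p (f v) \<and> length p = n) \<longleftrightarrow>
        (\<exists>p. u \<in> tverts S \<and> set p \<subseteq> tarcs S \<and> pcas u p v \<and> length p = n)" for n
    using rooted_iso_walk[OF f S, of u _ v] rooted_iso_walk[OF g T, of "f u" _ "f v"] gf[OF u] gf[OF v]
    by (metis length_map)
  then show ?thesis
    by (simp add: graph_dist_eq)
qed

lemma children_subset:
  assumes "rooted_tree T"
  shows "children T v \<subseteq> tverts T"
  using rooted_tree_arcs[OF assms] by (auto simp: children_def)

lemma rooted_iso_children:
  assumes f: "rooted_iso S T f" and S: "rooted_tree S" and T: "rooted_tree T" and v: "v \<in> tverts S"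
  shows "children T (f v) = f ` children S v"
proof -
  have root: "f (rt_root S) = rt_root T" and img: "f ` tverts S = tverts T"
    using f by (auto simp: rooted_iso_def bij_betw_def)
  have d: "graph_dist (rt_graph T) (rt_root T) (f x) = graph_dist (rt_graph S) (rt_root S) x"
    if "x \<in> tverts S" for x
    using rooted_iso_graph_dist[OF f S T rooted_tree_root[OF S] that] root by simp
  have "f w \<in> children T (f v) \<longleftrightarrow> w \<in> children S v" if "w \<in> tverts S" for w
    using f v that by (auto simp: children_def d rooted_iso_def)
  moreover have "children T (f v) \<subseteq> f ` tverts S" and "children S v \<subseteq> tverts S"
    using children_subset[OF S] children_subset[OF T] img by auto
  ultimately show ?thesis
    by fast
qed

text \<open>The rules for \<open>finprod\<close> (reindexing, splitting off a factor) ask for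
  factors in the carrier; this supplies that condition.\<close>

lemma node_value_closed:
  assumes "comm_monoid A" and "\<Xi> \<in> carrier A \<rightarrow> carrier A" and "rooted_tree T"
  shows "node_value A \<Xi> T v \<in> carrier A"
  using assms
proof (induction A \<Xi> T v rule: node_value.induct)
  case (1 A \<Xi> T v)
  interpret comm_monoid A by fact
  show ?case
  proof (cases "leaf T v")
    case True
    then show ?thesis
      using 1 by (auto simp: node_value.simps[of A \<Xi> T v])
  next
    case False
    then have "node_value A \<Xi> T w \<in> carrier A" if "w \<in> children T v" for w
      using 1 that by blast
    then have "finprod A (node_value A \<Xi> T) (children T v) \<in> carrier A"
      by (intro finprod_closed) auto
    then show ?thesis
      using 1 False by (auto simp: node_value.simps[of A \<Xi> T v])
  qed
qed

text \<open>Induction along the recursion of \<open>node_value\<close>: \<open>f\<close> maps the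
  children of \<open>v\<close> bijectively onto those of \<open>f v\<close>, so the product over the
  latter can be reindexed by \<open>f\<close>.\<close>

lemma rooted_iso_node_value:
  assumes "comm_monoid A" and "\<Xi> \<in> carrier A \<rightarrow> carrier A"
    and "rooted_iso S T f" and "rooted_tree S" and T: "rooted_tree T" and "v \<in> tverts S"
  shows "node_value A \<Xi> T (f v) = node_value A \<Xi> S v"
  using assms(1-4,6)
proof (induction A \<Xi> S v rule: node_value.induct)
  case (1 A \<Xi> S v)
  interpret comm_monoid A by fact
  note S = \<open>rooted_tree S\<close> and f = \<open>rooted_iso S T f\<close>
  have ch: "children T (f v) = f ` children S v"
    using f S T \<open>v \<in> tverts S\<close> by (rule rooted_iso_children)
  have leaf: "leaf T (f v) \<longleftrightarrow> leaf S v"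
    by (simp add: leaf_def ch)
  show ?case
  proof (cases "leaf S v")
    case True
    then show ?thesis
      using S T leaf by (simp add: node_value.simps[of A \<Xi> S v] node_value.simps[of A \<Xi> T "f v"])
  next
    case False
    have IH: "node_value A \<Xi> T (f w) = node_value A \<Xi> S w" if "w \<in> children S v" for w
      using 1 False that children_subset[OF S] by blast
    have inj: "inj_on f (children S v)"
      using f children_subset[OF S, of v] inj_on_subset
      unfolding rooted_iso_def bij_betw_def by blast
    have "finprod A (node_value A \<Xi> T) (f ` children S v) =
          finprod A (\<lambda>w. node_value A \<Xi> T (f w)) (children S v)"
      using inj node_value_closed[OF 1(2,3) T] by (intro finprod_reindex) auto
    also have "\<dots> = finprod A (node_value A \<Xi> S) (children S v)"
      using IH by (intro finprod_fundef_cong) auto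
    finally show ?thesis
      using S T leaf False
      by (simp add: node_value.simps[of A \<Xi> S v] node_value.simps[of A \<Xi> T "f v"] ch)
  qed
qed

lemma tree_invariant_isomorphic:
  assumes "comm_monoid A" and "\<Xi> \<in> carrier A \<rightarrow> carrier A"
    and "rooted_tree S" and "rooted_tree T" and "rooted_isomorphic S T"
  shows "tree_invariant A \<Xi> S = tree_invariant A \<Xi> T"
proof -
  obtain f where f: "rooted_iso S T f"
    using assms(5) by (auto simp: rooted_isomorphic_def)
  then have "f (rt_root S) = rt_root T"
    by (simp add: rooted_iso_def)
  then show ?thesis
    using rooted_iso_node_value[OF assms(1,2) f assms(3,4) rooted_tree_root[OF assms(3)]]
    by (simp add: tree_invariant_def)
qed

section \<open>Automorphisms\<close>

text \<open>The carrier of \<open>rooted_Aut T\<close> as a plain set. Extensionality gives every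
  automorphism exactly one representing function, so that \<open>card\<close> counts
  correctly.\<close>

definition auts :: "'v rooted_graph \<Rightarrow> ('v \<Rightarrow> 'v) set" where
  "auts T = {f \<in> extensional (tverts T). rooted_iso T T f}"

lemma aut_order_eq: "aut_order T = card (auts T)"
proof -
  have "{f \<in> Bij (tverts T). rooted_iso T T f} = auts T"
    by (auto simp: auts_def Bij_def rooted_iso_def)
  then show ?thesis
    by (simp add: aut_order_def rooted_Aut_def order_def)
qed

text \<open>Needed for comparing cardinalities, since \<open>card\<close> is 0 on infinite
  sets.\<close>

lemma finite_auts:
  assumes "finite (tverts T)"
  shows "finite (auts T)"
proof -
  have "auts T \<subseteq> (\<Pi>\<^sub>E x\<in>tverts T. tverts T)"
    by (auto simp: auts_def rooted_iso_def bij_betw_def PiE_def)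
  then show ?thesis
    using assms by (meson finite_PiE finite_subset)
qed

lemma restrict_in_auts:
  assumes "rooted_iso T T f" and "rt_root T \<in> tverts T"
  shows "restrict f (tverts T) \<in> auts T"
  using assms rooted_iso_cong[of T T f "restrict f (tverts T)"] by (auto simp: auts_def)

text \<open>Conjugation by \<open>h\<close> embeds the automorphisms of \<open>S\<close> into those
  of \<open>T\<close>. Equality of the orders follows by using the inverse isomorphism as
  well.\<close>

lemma aut_order_le:
  assumes h: "rooted_iso S T h" and S: "rooted_tree S" and T: "rooted_tree T"
  shows "aut_order S \<le> aut_order T"
proof -
  let ?k = "inv_into (tverts S) h"
  let ?F = "\<lambda>f. restrict (h \<circ> f \<circ> ?k) (tverts T)"
  have k: "rooted_iso T S ?k"
    using h rooted_tree_root[OF S] by (rule rooted_iso_inv_into)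
  have bij: "bij_betw h (tverts S) (tverts T)"
    using h by (simp add: rooted_iso_def)
  have "?F f \<in> auts T" if "f \<in> auts S" for f
    using that rooted_iso_comp[OF k rooted_iso_comp[OF _ h]] rooted_tree_root[OF T]
    by (intro restrict_in_auts) (auto simp: auts_def comp_assoc)
  moreover have "inj_on ?F (auts S)"
  proof (rule inj_onI)
    fix f g assume f: "f \<in> auts S" and g: "g \<in> auts S" and eq: "?F f = ?F g"
    have "f x = g x" if x: "x \<in> tverts S" for x
    proof -
      \<comment> \<open>Evaluating both conjugates at \<open>h x\<close> cancels the inverse, and
        injectivity of \<open>h\<close> then removes the outer \<open>h\<close>.\<close>
      have "h x \<in> tverts T" "?k (h x) = x"
        using x bij by (auto simp: bij_betw_def)
      then have "h (f x) = h (g x)"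
        using fun_cong[OF eq, of "h x"] by simp
      moreover have "f x \<in> tverts S" "g x \<in> tverts S"
        using f g x by (auto simp: auts_def rooted_iso_def bij_betw_def)
      ultimately show ?thesis
        using bij by (auto simp: bij_betw_def dest: inj_onD)
    qed
    then show "f = g"
      using f g by (auto simp: auts_def intro: extensionalityI)
  qed
  ultimately show ?thesis
    unfolding aut_order_eq using finite_auts[OF rooted_tree_finite[OF T]]
    by (intro card_inj_on_le[of ?F]) auto
qed

lemma aut_order_isomorphic:
  assumes "rooted_isomorphic S T" and "rooted_tree S" and "rooted_tree T"
  shows "aut_order S = aut_order T"
proof (rule antisym)
  show "aut_order S \<le> aut_order T"
    using assms aut_order_le unfolding rooted_isomorphic_def by blast
  have "rooted_isomorphic T S"
    using assms(1) rooted_tree_root[OF assms(2)] by (rule rooted_isomorphic_sym)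
  then show "aut_order T \<le> aut_order S"
    using assms(2,3) aut_order_le unfolding rooted_isomorphic_def by blast
qed

section \<open>Disjoint copies\<close>

text \<open>Infinitely many vertices lie outside \<open>F\<close>, so a set of the right size can be
  chosen there and the tree structure transported to it. This allows trees that overlap, or a tree
  and itself, to be joined.\<close>

lemma disjoint_copy:
  fixes T :: "'v rooted_graph" and F :: "('w::infinite) set"
  assumes T: "rooted_tree T" and "finite F"
  obtains T' :: "'w rooted_graph"
  where "rooted_tree T'" and "rooted_isomorphic T T'" and "tverts T' \<inter> F = {}"
proof -
  have "infinite (- F)"
    using \<open>finite F\<close> by (simp add: infinite_UNIV)
  then obtain B where B: "B \<subseteq> - F" "finite B" "card B = card (tverts T)"
    using infinite_arbitrarily_large by blast
  obtain g where g: "bij_betw g (tverts T) B"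
    using finite_same_card_bij[OF rooted_tree_finite[OF T] B(2)] B(3) by metis
  define T' where
    "T' = \<lparr>rt_graph = \<lparr>pverts = B, parcs = map_prod g g ` tarcs T\<rparr>, rt_root = g (rt_root T)\<rparr>"
  have [simp]: "tverts T' = B" "tarcs T' = map_prod g g ` tarcs T" "rt_root T' = g (rt_root T)"
    by (simp_all add: T'_def)
  let ?h = "inv_into (tverts T) g"
  note arcs = rooted_tree_arcs[OF T]
  have inj: "inj_on g (tverts T)" and img: "g ` tverts T = B"
    using g by (auto simp: bij_betw_def)
  have hg: "?h (g x) = x" if "x \<in> tverts T" for x
    using inj that by simp
  have iff: "(g u, g v) \<in> tarcs T' \<longleftrightarrow> (u, v) \<in> tarcs T"
    if "u \<in> tverts T" "v \<in> tverts T" for u v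
    using inj that arcs by (auto dest: inj_onD)
  have "rooted_tree T'"
    unfolding rooted_tree_iff
  proof (intro conjI allI impI ballI)
    show "finite (tverts T')" using B by simp
    show "tarcs T' \<subseteq> tverts T' \<times> tverts T'" using arcs img by auto
    show "sym (tarcs T')" using rooted_tree_sym[OF T] by (force simp: sym_def)
    show "irrefl (tarcs T')"
      using T inj arcs by (auto simp: irrefl_def rooted_tree_iff dest!: inj_onD)
    show "rt_root T' \<in> tverts T'" using rooted_tree_root[OF T] img by auto
  next
    fix y assume "y \<in> tverts T'"
    then obtain x where x: "x \<in> tverts T" "y = g x" using img by auto
    have "(rt_root T, x) \<in> (tarcs T)\<^sup>*" using rooted_tree_reach[OF T] x by simp
    then have "(g (rt_root T), g x) \<in> (tarcs T')\<^sup>*"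
    proof (induction rule: rtrancl_induct)
      case (step a b)
      then have "(g a, g b) \<in> tarcs T'" by force
      with step.IH show ?case by (rule rtrancl_into_rtrancl)
    qed simp
    then show "(rt_root T', y) \<in> (tarcs T')\<^sup>*" using x by simp
  next
    \<comment> \<open>A cycle of the copy is pulled back along \<open>?h\<close>; its heads stay
      distinct because \<open>?h\<close> is injective on \<open>B\<close>.\<close>
    fix u p assume p: "set p \<subseteq> tarcs T'" "pcas u p u" "distinct (map snd p)"
    have "set (map (map_prod ?h ?h) p) \<subseteq> tarcs T"
      using p(1) arcs hg by fastforce
    moreover have "pcas (?h u) (map (map_prod ?h ?h) p) (?h u)"
      using p(2) by (rule pcas_map)
    moreover have "distinct (map snd (map (map_prod ?h ?h) p))"
    proof -
      have "snd ` set p \<subseteq> B" using p(1) arcs img by auto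
      then have "inj_on ?h (set (map snd p))"
        using inj_on_inv_into[of _ g "tverts T"] img by simp
      then have "distinct (map ?h (map snd p))"
        using p(3) by (simp only: distinct_map)
      then show ?thesis by (simp add: comp_def del: distinct_map)
    qed
    ultimately have "length (map (map_prod ?h ?h) p) < 3"
      using T unfolding rooted_tree_iff by blast
    then show "length p < 3" by simp
  qed
  moreover have "rooted_iso T T' g"
    using g iff unfolding rooted_iso_def by auto
  ultimately show ?thesis
    using that[of T'] B(1) by (auto simp: rooted_isomorphic_def)
qed

section \<open>Joining two trees at a new root\<close>

text \<open>The tree \<open>[S, T]\<close>, built as a plain union with the new root
  \<open>r\<close> as a parameter, so that it stays within the vertex type of \<open>S\<close> and
  \<open>T\<close>. Disjointness and freshness of \<open>r\<close> are left to the locale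
  \<open>tree_join\<close>.\<close>

definition join_trees :: "'v \<Rightarrow> 'v rooted_graph \<Rightarrow> 'v rooted_graph \<Rightarrow> 'v rooted_graph" where
  "join_trees r S T =
     \<lparr>rt_graph =
        \<lparr>pverts = insert r (tverts S \<union> tverts T),
         parcs = tarcs S \<union> tarcs T \<union>
           {(r, rt_root S), (rt_root S, r), (r, rt_root T), (rt_root T, r)}\<rparr>,
      rt_root = r\<rparr>"

lemma join_trees_simps [simp]:
  "tverts (join_trees r S T) = insert r (tverts S \<union> tverts T)"
  "tarcs (join_trees r S T) = tarcs S \<union> tarcs T \<union>
     {(r, rt_root S), (rt_root S, r), (r, rt_root T), (rt_root T, r)}"
  "rt_root (join_trees r S T) = r"
  by (simp_all add: join_trees_def)

lemma join_trees_commute: "join_trees r S T = join_trees r T S"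
  by (auto simp: join_trees_def)

section \<open>The join of two disjoint trees is a rooted tree\<close>

locale tree_join =
  fixes r :: 'v and S T :: "'v rooted_graph"
  assumes trees: "rooted_tree S" "rooted_tree T"
    and fresh: "r \<notin> tverts S" "r \<notin> tverts T"
    and disjoint: "tverts S \<inter> tverts T = {}"
begin

text \<open>Together with \<open>join_trees_commute\<close> this turns facts about the branch
  \<open>S\<close> into facts about \<open>T\<close>, so that only one side has to be
  proved.\<close>

lemma swap: "tree_join r T S"
  using trees fresh disjoint by unfold_locales auto

lemmas roots = rooted_tree_root[OF trees(1)] rooted_tree_root[OF trees(2)]
lemmas arcs = rooted_tree_arcs[OF trees(1)] rooted_tree_arcs[OF trees(2)]

lemma root_neq: "rt_root S \<noteq> rt_root T" "rt_root S \<noteq> r" "rt_root T \<noteq> r"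
  using roots fresh disjoint by auto

lemma arc_from_left:
  assumes "(u, v) \<in> tarcs (join_trees r S T)" and "u \<in> tverts S" and "v \<noteq> r"
  shows "(u, v) \<in> tarcs S"
  using assms arcs fresh disjoint roots by auto

lemma arc_left_iff:
  assumes "u \<in> tverts S" and "v \<in> tverts S"
  shows "(u, v) \<in> tarcs (join_trees r S T) \<longleftrightarrow> (u, v) \<in> tarcs S"
  using assms arc_from_left[of u v] fresh by auto

lemma arc_from_root_iff: "(r, v) \<in> tarcs (join_trees r S T) \<longleftrightarrow> v = rt_root S \<or> v = rt_root T"
  using arcs fresh by auto

lemma arc_to_root_iff: "(v, r) \<in> tarcs (join_trees r S T) \<longleftrightarrow> v = rt_root S \<or> v = rt_root T"
  using arcs fresh by auto

text \<open>The only arc of the join that leaves \<open>S\<close> leads to \<open>r\<close>, so a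
  walk that starts in \<open>S\<close> and never enters \<open>r\<close> remains in
  \<open>S\<close>.\<close>

lemma walk_stays_left:
  assumes "set p \<subseteq> tarcs (join_trees r S T)" and "pcas u p v" and "u \<in> tverts S" and "r \<notin> snd ` set p"
  shows "set p \<subseteq> tarcs S \<and> v \<in> tverts S"
  using assms
proof (induction p arbitrary: u)
  case (Cons e p)
  then have "(u, snd e) \<in> tarcs S"
    by (intro arc_from_left) auto
  moreover have "set p \<subseteq> tarcs S \<and> v \<in> tverts S"
    using Cons calculation arcs by auto
  ultimately show ?case
    using Cons.prems(2) by auto
qed simp

lemma walk_avoiding_root_stays:
  assumes "set p \<subseteq> tarcs (join_trees r S T)" and "pcas u p v"
    and "u \<in> tverts (join_trees r S T)" and "u \<noteq> r" and "r \<notin> snd ` set p"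
  obtains "set p \<subseteq> tarcs S" "u \<in> tverts S" "v \<in> tverts S"
  | "set p \<subseteq> tarcs T" "u \<in> tverts T" "v \<in> tverts T"
proof (cases "u \<in> tverts S")
  case True
  with assms walk_stays_left[of p u v] that(1) show ?thesis by blast
next
  case False
  with assms have "u \<in> tverts T" by simp
  with assms tree_join.walk_stays_left[OF swap, of p u v] that(2) show ?thesis
    by (metis join_trees_commute)
qed

text \<open>A cycle avoiding \<open>r\<close> lies in one branch, which is acyclic. A cycle through
  \<open>r\<close> leaves it for the root of a branch and can only return from that same root, which
  would therefore be visited twice.\<close>

lemma join_acyclic:
  assumes p: "set p \<subseteq> tarcs (join_trees r S T)" "pcas u p u" "distinct (map snd p)"
  shows "length p < 3"
proof (rule ccontr)
  assume len: "\<not> length p < 3"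
  show False
  proof (cases "r \<in> snd ` set p")
    case False
    \<comment> \<open>The base \<open>u\<close> is not assumed to be a vertex; as the head of an arc
      it is one, and it differs from \<open>r\<close>.\<close>
    have "u \<in> snd ` set p"
      using pcas_last_in_heads[OF p(2)] len by (cases "p = []") auto
    then obtain w where "(w, u) \<in> set p"
      by (metis imageE prod.collapse)
    then have "(w, u) \<in> tarcs (join_trees r S T)" "u \<noteq> r"
      using False p(1) by (blast, metis image_eqI snd_conv)
    then have "u \<noteq> r" "u \<in> tverts (join_trees r S T)"
      using arcs roots by auto
    from p(1,2) this(2,1) False show False
    proof (cases rule: walk_avoiding_root_stays)
      case 1
      then show ?thesis using trees(1) p len unfolding rooted_tree_iff by blast
    next
      case 2
      then show ?thesis using trees(2) p len unfolding rooted_tree_iff by blast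
    qed
  next
    case True
    \<comment> \<open>Rotate the cycle so that it starts at the new root.\<close>
    then obtain x p1 p2 where split: "p = p1 @ (x, r) # p2"
      by (metis imageE prod.collapse split_list)
    have "pcas r (p2 @ p1) x"
      using p(2) by (auto simp: split pcas_append)
    \<comment> \<open>Without the arc into \<open>r\<close> at least two arcs remain:
      \<open>e\<close>, which leaves \<open>r\<close>, and a nonempty rest \<open>q\<close>.\<close>
    moreover obtain e q where q: "p2 @ p1 = e # q" "q \<noteq> []"
    proof -
      have "\<not> length (p2 @ p1) < 2"
        using len by (simp add: split)
      then show ?thesis
        using that by (cases "p2 @ p1") (auto simp del: length_append)
    qed
    ultimately obtain y where y: "e = (r, y)" "pcas y q x"
      by (cases e) auto
    have arcs_q: "set (e # q) \<subseteq> tarcs (join_trees r S T)" "(x, r) \<in> tarcs (join_trees r S T)"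
      using p(1) by (auto simp: split simp flip: q(1))
    \<comment> \<open>In the rotated cycle \<open>y\<close> is the head of the first arc and
      \<open>r\<close> that of the last, so neither is a head in the middle part
      \<open>q\<close>.\<close>
    have "distinct (map snd ((p2 @ p1) @ [(x, r)]))"
      using p(3) by (auto simp: split)
    then have d: "r \<notin> snd ` set q" "y \<notin> snd ` set q"
      unfolding q(1) using y by auto
    have xy: "y = rt_root S \<or> y = rt_root T" "x = rt_root S \<or> x = rt_root T"
      using arcs_q y arc_from_root_iff arc_to_root_iff by (auto simp del: join_trees_simps)
    \<comment> \<open>The walk \<open>q\<close> avoids \<open>r\<close>, so its ends
      \<open>x\<close> and \<open>y\<close> lie in the same branch; both are branch roots.\<close>
    have "x = y"
      using arcs_q(1) y(2) d(1) xy roots root_neq disjoint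
      by (elim walk_avoiding_root_stays[of q y x, rotated 4]) auto
    then show False
      using pcas_last_in_heads[OF y(2) q(2)] d(2) by simp
  qed
qed

lemma rooted_tree_join: "rooted_tree (join_trees r S T)"
  unfolding rooted_tree_iff
proof (intro conjI allI impI ballI)
  show "finite (tverts (join_trees r S T))" using trees by (simp add: rooted_tree_finite)
  show "tarcs (join_trees r S T) \<subseteq> tverts (join_trees r S T) \<times> tverts (join_trees r S T)"
    using arcs roots by auto
  show "sym (tarcs (join_trees r S T))"
    using trees[THEN rooted_tree_sym] by (auto simp: sym_def)
  show "irrefl (tarcs (join_trees r S T))"
    using trees root_neq by (auto simp: irrefl_def rooted_tree_iff)
  show "rt_root (join_trees r S T) \<in> tverts (join_trees r S T)" by simp
next
  fix v assume v: "v \<in> tverts (join_trees r S T)"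
  have "(r, v) \<in> (tarcs (join_trees r S T))\<^sup>*"
    if X: "rooted_tree X" "tarcs X \<subseteq> tarcs (join_trees r S T)" "(r, rt_root X) \<in> tarcs (join_trees r S T)"
      "v \<in> tverts X" for X
  proof -
    have "(rt_root X, v) \<in> (tarcs (join_trees r S T))\<^sup>*"
      using rooted_tree_reach[OF X(1,4)] X(2) rtrancl_mono by blast
    with X(3) show ?thesis by (rule converse_rtrancl_into_rtrancl)
  qed
  from this[of S] this[of T] v trees show "(rt_root (join_trees r S T), v) \<in> (tarcs (join_trees r S T))\<^sup>*"
    by auto
qed (use join_acyclic in auto)

section \<open>Distances, children and the invariant in a join\<close>

text \<open>Collapsing \<^term>\<open>r\<close> and \<^term>\<open>T\<close> onto the root of \<^term>\<open>S\<close> does not lengthen walks.\<close>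

lemma walk_collapse:
  assumes "set p \<subseteq> tarcs (join_trees r S T)" and "pcas u p v" and "v \<in> tverts S"
  shows "\<exists>q. set q \<subseteq> tarcs S \<and> pcas (if u \<in> tverts S then u else rt_root S) q v \<and>
    length q \<le> length p \<and> (u = r \<longrightarrow> length q < length p)"
  using assms
proof (induction p arbitrary: u)
  case Nil
  then show ?case using fresh by (auto intro: exI[of _ "[]"])
next
  case (Cons e p)
  obtain w where e: "e = (u, w)" "pcas w p v" and uw: "(u, w) \<in> tarcs (join_trees r S T)"
    using Cons.prems by (cases e) auto
  obtain q where q: "set q \<subseteq> tarcs S" "pcas (if w \<in> tverts S then w else rt_root S) q v"
    "length q \<le> length p"
    using Cons.IH[of w] Cons.prems e by auto
  show ?case
  proof (cases "(u, w) \<in> tarcs S")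
    case True
    then show ?thesis
      using q e arcs fresh by (intro exI[of _ "(u, w) # q"]) auto
  next
    case False
    \<comment> \<open>Both ends of an arc outside \<open>S\<close> collapse to the root of
      \<open>S\<close>, so the arc is dropped. Every arc starting at \<open>r\<close> is of this
      kind, which gives the strict inequality.\<close>
    then have "(if w \<in> tverts S then w else rt_root S) = (if u \<in> tverts S then u else rt_root S)"
      using uw arcs roots fresh disjoint by auto
    then show ?thesis
      using q by (intro exI[of _ q]) auto
  qed
qed

text \<open>Prefixing the arc from \<open>r\<close> to the root of \<open>S\<close> to a shortest
  walk gives one bound; the other holds because \<open>walk_collapse\<close> makes every walk from
  \<open>r\<close> strictly shorter.\<close>

lemma graph_dist_join:
  assumes v: "v \<in> tverts S"
  shows "graph_dist (rt_graph (join_trees r S T)) r v = Suc (graph_dist (rt_graph S) (rt_root S) v)"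
proof -
  let ?P = "\<lambda>n. \<exists>p. rt_root S \<in> tverts S \<and> set p \<subseteq> tarcs S \<and> pcas (rt_root S) p v \<and> length p = n"
  let ?Q = "\<lambda>n. \<exists>p. r \<in> tverts (join_trees r S T) \<and> set p \<subseteq> tarcs (join_trees r S T) \<and> pcas r p v \<and>
    length p = n"
  \<comment> \<open>\<open>LEAST\<close> is attained only if some walk exists, so reachability is
    first turned into a walk.\<close>
  have reach: "\<exists>p. set p \<subseteq> tarcs S \<and> pcas (rt_root S) p v"
    using rooted_tree_reach[OF trees(1) v]
  proof (induction rule: rtrancl_induct)
    case base
    show ?case by (auto intro: exI[of _ "[]"])
  next
    case (step a b)
    then obtain p where "set p \<subseteq> tarcs S" "pcas (rt_root S) p a" by blast
    then show ?case using step by (intro exI[of _ "p @ [(a, b)]"]) (auto simp: pcas_append)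
  qed
  then have P: "?P (LEAST n. ?P n)"
    using roots by (intro LeastI_ex[of ?P]) blast
  show ?thesis
    unfolding graph_dist_eq
  proof (rule Least_equality)
    from P obtain p where "set p \<subseteq> tarcs S" "pcas (rt_root S) p v" "length p = (LEAST n. ?P n)"
      by blast
    then show "?Q (Suc (LEAST n. ?P n))"
      by (intro exI[of _ "(r, rt_root S) # p"]) auto
  next
    fix n assume "?Q n"
    then obtain p where "set p \<subseteq> tarcs (join_trees r S T)" "pcas r p v" "length p = n"
      by blast
    then obtain q where q: "set q \<subseteq> tarcs S" "pcas (rt_root S) q v" "length q < n"
      using walk_collapse[of p r v] v fresh by auto
    then have "(LEAST n. ?P n) \<le> length q"
      using roots by (intro Least_le[of ?P]) blast
    with q show "Suc (LEAST n. ?P n) \<le> n" by simp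
  qed
qed

lemma graph_dist_join_root: "graph_dist (rt_graph (join_trees r S T)) r r = 0"
  unfolding graph_dist_eq by (rule Least_eq_0) (auto intro: exI[of _ "[]"])

text \<open>All distances in \<open>S\<close> grow by one, which leaves their comparison unchanged,
  and the new neighbour \<open>r\<close> is no child because it has distance 0.\<close>

lemma children_join_left:
  assumes v: "v \<in> tverts S"
  shows "children (join_trees r S T) v = children S v"
proof -
  have "w \<in> children (join_trees r S T) v \<longleftrightarrow> w \<in> children S v" for w
  proof (cases "w \<in> tverts S")
    case True
    then show ?thesis
      using v arc_left_iff[OF v True] by (simp add: children_def graph_dist_join del: join_trees_simps(2))
  next
    case False
    then have "w \<notin> children S v"
      using children_subset[OF trees(1)] by blast
    moreover have "w \<notin> children (join_trees r S T) v"
      using False v arc_from_left[of v w] arcs graph_dist_join_root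
      by (cases "w = r") (auto simp: children_def)
    ultimately show ?thesis by simp
  qed
  then show ?thesis by blast
qed

lemma node_value_join_left:
  assumes "v \<in> tverts S"
  shows "node_value A \<Xi> (join_trees r S T) v = node_value A \<Xi> S v"
  \<comment> \<open>The induction generalises \<open>S\<close>, so the locale assumptions are passed
    through it as a premise and interpreted anew.\<close>
  using tree_join_axioms assms
proof (induction A \<Xi> S v rule: node_value.induct)
  case (1 A \<Xi> S v)
  interpret tree_join r S T by fact
  have ch: "children (join_trees r S T) v = children S v"
    using \<open>v \<in> tverts S\<close> by (rule children_join_left)
  have leaf: "leaf (join_trees r S T) v \<longleftrightarrow> leaf S v"
    by (simp add: leaf_def ch)
  have "node_value A \<Xi> (join_trees r S T) w = node_value A \<Xi> S w"
    if "\<not> leaf S v" "w \<in> children S v" for w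
    using 1 trees(1) that children_subset[OF trees(1)] by blast
  then have "finprod A (node_value A \<Xi> (join_trees r S T)) (children S v) =
      finprod A (node_value A \<Xi> S) (children S v)" if "\<not> leaf S v"
    using that by (intro finprod_fundef_cong) auto
  then show ?case
    using trees(1) rooted_tree_join leaf ch
    by (simp add: node_value.simps[of A \<Xi> S v] node_value.simps[of A \<Xi> "join_trees r S T" v])
qed

lemma children_join_root: "children (join_trees r S T) r = {rt_root S, rt_root T}"
proof -
  have "0 < graph_dist (rt_graph (join_trees r S T)) r (rt_root S)"
    using graph_dist_join[OF roots(1)] by simp
  moreover have "0 < graph_dist (rt_graph (join_trees r S T)) r (rt_root T)"
    using tree_join.graph_dist_join[OF swap roots(2)] by (simp add: join_trees_commute)
  ultimately show ?thesis
    unfolding children_def join_trees_simps(3) graph_dist_join_root arc_from_root_iff by auto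
qed

text \<open>The children of \<open>r\<close> are the two branch roots, which keep their values. They
  are distinct vertices even if the branches are isomorphic, so the product always has two
  factors.\<close>

lemma tree_invariant_join:
  assumes "comm_monoid A" and "\<Xi> \<in> carrier A \<rightarrow> carrier A"
  shows "tree_invariant A \<Xi> (join_trees r S T) =
    \<Xi> (tree_invariant A \<Xi> S \<otimes>\<^bsub>A\<^esub> tree_invariant A \<Xi> T)"
proof -
  interpret comm_monoid A by fact
  have S: "node_value A \<Xi> (join_trees r S T) (rt_root S) = tree_invariant A \<Xi> S"
    using node_value_join_left roots by (simp add: tree_invariant_def)
  have T: "node_value A \<Xi> (join_trees r S T) (rt_root T) = tree_invariant A \<Xi> T"
    using tree_join.node_value_join_left[OF swap] roots
    by (simp add: tree_invariant_def join_trees_commute[of r S T])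
  note closed = node_value_closed[OF assms rooted_tree_join]
  have "finprod A (node_value A \<Xi> (join_trees r S T)) {rt_root S, rt_root T} =
      tree_invariant A \<Xi> S \<otimes>\<^bsub>A\<^esub> tree_invariant A \<Xi> T"
    using closed root_neq closed[of "rt_root S"] closed[of "rt_root T"] by (simp add: S T Pi_iff)
  then show ?thesis
    using rooted_tree_join
    by (simp add: tree_invariant_def node_value.simps[of A \<Xi> "join_trees r S T" r]
        leaf_def children_join_root)
qed

end

section \<open>Automorphisms of a join\<close>

text \<open>Stated between two joins so that it yields both the automorphisms acting on each branch
  separately and, with the branches of the second join in the opposite order, the swap.\<close>

lemma rooted_iso_join:
  assumes "tree_join r S T" and "tree_join r' S' T'"
    and g: "rooted_iso S S' g" and h: "rooted_iso T T' h"
  shows "rooted_iso (join_trees r S T) (join_trees r' S' T')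
    (\<lambda>x. if x \<in> tverts S then g x else if x \<in> tverts T then h x else r')" (is "rooted_iso ?J ?J' ?f")
proof -
  interpret A: tree_join r S T by fact
  interpret B: tree_join r' S' T' by fact
  have fS: "?f x = g x" if "x \<in> tverts S" for x
    using that by simp
  have fT: "?f x = h x" if "x \<in> tverts T" for x
    using that A.disjoint by auto
  have fr: "?f r = r'"
    using A.fresh by simp
  have bg: "bij_betw g (tverts S) (tverts S')" and bh: "bij_betw h (tverts T) (tverts T')"
    and roots: "g (rt_root S) = rt_root S'" "h (rt_root T) = rt_root T'"
    using g h by (auto simp: rooted_iso_def)
  have b: "bij_betw ?f (tverts ?J) (tverts ?J')"
  proof -
    have "bij_betw ?f (tverts S) (tverts S')"
      using bg by (subst bij_betw_cong[of _ _ g]) auto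
    moreover have "bij_betw ?f (tverts T) (tverts T')"
      using bh fT by (subst bij_betw_cong[of _ _ h]) auto
    ultimately have "bij_betw ?f (tverts S \<union> tverts T) (tverts S' \<union> tverts T')"
      using B.disjoint by (rule bij_betw_combine)
    moreover have "bij_betw ?f {r} {r'}"
      unfolding bij_betw_def image_insert fr by simp
    moreover have "(tverts S' \<union> tverts T') \<inter> {r'} = {}"
      using B.fresh by simp
    ultimately have "bij_betw ?f ((tverts S \<union> tverts T) \<union> {r}) ((tverts S' \<union> tverts T') \<union> {r'})"
      by (rule bij_betw_combine)
    then show ?thesis by simp
  qed
  have mem: "g x \<in> tverts S'" if "x \<in> tverts S" for x
    using bg that by (auto simp: bij_betw_def)
  have mem': "h x \<in> tverts T'" if "x \<in> tverts T" for x
    using bh that by (auto simp: bij_betw_def)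
  have inj: "?f u = ?f v \<longleftrightarrow> u = v" if "u \<in> tverts ?J" "v \<in> tverts ?J" for u v
    using bij_betw_imp_inj_on[OF b] that by (rule inj_on_eq_iff)
  have "(u, v) \<in> tarcs ?J \<longleftrightarrow> (?f u, ?f v) \<in> tarcs ?J'"
    if u: "u \<in> tverts ?J" and v: "v \<in> tverts ?J" for u v
  proof -
    have S: "(u, v) \<in> tarcs S \<longleftrightarrow> (?f u, ?f v) \<in> tarcs S'"
    proof (cases "u \<in> tverts S \<and> v \<in> tverts S")
      case True
      then show ?thesis using g fS by (simp add: rooted_iso_def)
    next
      case False
      \<comment> \<open>A vertex outside \<open>S\<close> is \<open>r\<close> or lies in
        \<open>T\<close>, so it is sent to \<open>r'\<close> or into \<open>T'\<close>, hence
        outside \<open>S'\<close>.\<close>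
      then have "?f u \<notin> tverts S' \<or> ?f v \<notin> tverts S'"
        using u v mem' fr fT B.fresh B.disjoint by auto
      then show ?thesis using False A.arcs B.arcs by blast
    qed
    have T: "(u, v) \<in> tarcs T \<longleftrightarrow> (?f u, ?f v) \<in> tarcs T'"
    proof (cases "u \<in> tverts T \<and> v \<in> tverts T")
      case True
      then show ?thesis using h fT by (simp add: rooted_iso_def)
    next
      case False
      then have "?f u \<notin> tverts T' \<or> ?f v \<notin> tverts T'"
        using u v mem fr fS B.fresh B.disjoint by auto
      then show ?thesis using False A.arcs B.arcs by blast
    qed
    \<comment> \<open>By injectivity \<open>?f\<close> detects the three vertices that carry the
      added edges, so these edges correspond as well.\<close>
    have r: "x = r \<longleftrightarrow> ?f x = r'" "x = rt_root S \<longleftrightarrow> ?f x = rt_root S'"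
      "x = rt_root T \<longleftrightarrow> ?f x = rt_root T'" if "x \<in> tverts ?J" for x
      using inj[OF that, of r] inj[OF that, of "rt_root S"] inj[OF that, of "rt_root T"]
        fr fS fT A.roots roots by auto
    show ?thesis
      using S T r[OF u] r[OF v] by (simp del: if_split_asm)
  qed
  then show ?thesis
    using b fr unfolding rooted_iso_def join_trees_simps(3) by blast
qed

section \<open>Restricting isomorphisms of joins to the branches\<close>

lemma rooted_iso_join_root:
  assumes "tree_join r S T" and "tree_join r' S' T'"
    and f: "rooted_iso (join_trees r S T) (join_trees r' S' T') f"
  shows "f (rt_root S) = rt_root S' \<or> f (rt_root S) = rt_root T'"
proof -
  interpret A: tree_join r S T by fact
  interpret B: tree_join r' S' T' by fact
  have "(r, rt_root S) \<in> tarcs (join_trees r S T)" and "f r = r'"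
    using f by (auto simp: rooted_iso_def)
  then have "(r', f (rt_root S)) \<in> tarcs (join_trees r' S' T')"
    using rooted_iso_arc_iff[OF f, of r "rt_root S"] A.roots by (simp del: join_trees_simps(2))
  then show ?thesis
    using B.arc_from_root_iff by blast
qed

text \<open>Induction along a path from the root of \<open>S\<close>: its image starts in
  \<open>S'\<close> and cannot leave, since the only exit is \<open>r'\<close>, which is the image
  of \<open>r\<close> alone.\<close>

lemma rooted_iso_join_image:
  assumes "tree_join r S T" and "tree_join r' S' T'"
    and f: "rooted_iso (join_trees r S T) (join_trees r' S' T') f"
    and root: "f (rt_root S) = rt_root S'"
  shows "f ` tverts S \<subseteq> tverts S'"
proof -
  interpret A: tree_join r S T by fact
  interpret B: tree_join r' S' T' by fact
  have fr: "f r = r'" and inj: "inj_on f (tverts (join_trees r S T))"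
    using f by (auto simp: rooted_iso_def bij_betw_def)
  have "f v \<in> tverts S'" if "v \<in> tverts S" for v
    using rooted_tree_reach[OF A.trees(1) that]
  proof (induction rule: rtrancl_induct)
    case base
    then show ?case using root B.roots by simp
  next
    case (step a b)
    have ab: "a \<in> tverts S" "b \<in> tverts S"
      using step A.arcs by auto
    then have "(f a, f b) \<in> tarcs (join_trees r' S' T')"
      using step(2) by (subst rooted_iso_arc_iff[OF f]) auto
    moreover have "f b \<noteq> r'"
      using inj ab A.fresh fr by (metis UnI1 inj_on_eq_iff insertCI join_trees_simps(1))
    ultimately have "(f a, f b) \<in> tarcs S'"
      using step.IH by (intro B.arc_from_left)
    then show ?case using B.arcs by blast
  qed
  then show ?thesis by blast
qed

text \<open>Injectivity forces the root of \<open>T\<close> onto that of \<open>T'\<close>, so each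
  branch maps into the corresponding one. As \<open>f\<close> is onto, no vertex of
  \<open>S'\<close> can come from \<open>T\<close> or \<open>r\<close>, so \<open>S\<close> covers
  \<open>S'\<close>.\<close>

lemma rooted_iso_join_left:
  assumes A: "tree_join r S T" and B: "tree_join r' S' T'"
    and f: "rooted_iso (join_trees r S T) (join_trees r' S' T') f"
    and root: "f (rt_root S) = rt_root S'"
  shows "rooted_iso S S' f" and "f (rt_root T) = rt_root T'"
proof -
  interpret A: tree_join r S T by fact
  interpret B: tree_join r' S' T' by fact
  have f': "rooted_iso (join_trees r T S) (join_trees r' T' S') f"
    using f by (simp add: join_trees_commute)
  have inj: "inj_on f (tverts (join_trees r S T))"
    and img: "f ` tverts (join_trees r S T) = tverts (join_trees r' S' T')" and fr: "f r = r'"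
    using f by (auto simp: rooted_iso_def bij_betw_def)
  have "f (rt_root T) \<noteq> f (rt_root S)"
    using inj A.roots A.root_neq by (auto dest: inj_onD)
  then show rootT: "f (rt_root T) = rt_root T'"
    using rooted_iso_join_root[OF A.swap B.swap f'] root by auto
  have S: "f ` tverts S \<subseteq> tverts S'"
    using A B f root by (rule rooted_iso_join_image)
  have T: "f ` tverts T \<subseteq> tverts T'"
    using A.swap B.swap f' rootT by (rule rooted_iso_join_image)
  have "tverts S' \<subseteq> f ` tverts S"
  proof
    fix y assume y: "y \<in> tverts S'"
    then obtain x where "x \<in> tverts (join_trees r S T)" "y = f x"
      using img by auto
    then show "y \<in> f ` tverts S"
      using y T fr B.fresh B.disjoint by auto
  qed
  then have "bij_betw f (tverts S) (tverts S')"
    using S inj by (auto simp: bij_betw_def intro: inj_on_subset)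
  moreover have "(u, v) \<in> tarcs S \<longleftrightarrow> (f u, f v) \<in> tarcs S'"
    if "u \<in> tverts S" "v \<in> tverts S" for u v
  proof -
    have "(f u, f v) \<in> tarcs (join_trees r' S' T') \<longleftrightarrow> (u, v) \<in> tarcs (join_trees r S T)"
      using that by (intro rooted_iso_arc_iff[OF f]) auto
    then show ?thesis
      using A.arc_left_iff B.arc_left_iff that S by blast
  qed
  ultimately show "rooted_iso S S' f"
    using root by (simp add: rooted_iso_def)
qed

lemma rooted_iso_join_right:
  assumes "tree_join r S T" and "tree_join r' S' T'"
    and "rooted_iso (join_trees r S T) (join_trees r' S' T') f"
    and "f (rt_root S) = rt_root S'"
  shows "rooted_iso T T' f"
proof (rule rooted_iso_join_left(1))
  show "tree_join r T S" "tree_join r' T' S'"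
    using assms(1,2) by (simp_all add: tree_join.swap)
  show "rooted_iso (join_trees r T S) (join_trees r' T' S') f"
    using assms(3) by (simp add: join_trees_commute)
  show "f (rt_root T) = rt_root T'"
    using assms by (rule rooted_iso_join_left(2))
qed

section \<open>Counting the automorphisms of a join\<close>

context tree_join
begin

text \<open>An automorphism fixing the root of \<open>S\<close> preserves both branches. Restricting
  to the branches and gluing are mutually inverse, because \<open>r\<close> is fixed and all
  functions are extensional.\<close>

lemma card_auts_fixing_branches:
  "card {f \<in> auts (join_trees r S T). f (rt_root S) = rt_root S} = aut_order S * aut_order T"
  (is "card ?F = _")
proof -
  let ?J = "join_trees r S T"
  let ?res = "\<lambda>f. (restrict f (tverts S), restrict f (tverts T))"
  let ?glue = "\<lambda>(g, h). restrict
    (\<lambda>x. if x \<in> tverts S then g x else if x \<in> tverts T then h x else r) (tverts ?J)"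
  have r: "rt_root ?J \<in> tverts ?J" by simp
  have "bij_betw ?res ?F (auts S \<times> auts T)"
  proof (rule bij_betw_byWitness[where f' = ?glue])
    show "\<forall>f\<in>?F. ?glue (?res f) = f"
    proof
      fix f assume f: "f \<in> ?F"
      then have "f r = r" "f \<in> extensional (tverts ?J)"
        by (auto simp: auts_def rooted_iso_def)
      then show "?glue (?res f) = f"
        by (intro extensionalityI[of _ "tverts ?J"]) auto
    qed
    show "\<forall>gh\<in>auts S \<times> auts T. ?res (?glue gh) = gh"
    proof
      fix gh assume "gh \<in> auts S \<times> auts T"
      then obtain g h where gh: "gh = (g, h)"
        "g \<in> extensional (tverts S)" "h \<in> extensional (tverts T)"
        by (auto simp: auts_def)
      have "restrict (?glue gh) (tverts S) = g"
        using gh by (intro extensionalityI[of _ "tverts S"]) auto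
      moreover have "restrict (?glue gh) (tverts T) = h"
        using gh disjoint by (intro extensionalityI[of _ "tverts T"]) auto
      ultimately show "?res (?glue gh) = gh"
        using gh(1) by simp
    qed
    show "?res ` ?F \<subseteq> auts S \<times> auts T"
    proof safe
      fix f assume "f \<in> auts ?J" and root: "f (rt_root S) = rt_root S"
      then have f: "rooted_iso ?J ?J f" by (simp add: auts_def)
      show "restrict f (tverts S) \<in> auts S"
        using rooted_iso_join_left(1)[OF tree_join_axioms tree_join_axioms f root] roots(1)
        by (rule restrict_in_auts)
      show "restrict f (tverts T) \<in> auts T"
        using rooted_iso_join_right[OF tree_join_axioms tree_join_axioms f root] roots(2)
        by (rule restrict_in_auts)
    qed
    have "?glue (g, h) \<in> ?F" if "g \<in> auts S" "h \<in> auts T" for g h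
    proof -
      have g: "rooted_iso S S g" and h: "rooted_iso T T h"
        using that by (auto simp: auts_def)
      have "?glue (g, h) \<in> auts ?J"
        unfolding prod.case
        using rooted_iso_join[OF tree_join_axioms tree_join_axioms g h] r
        by (rule restrict_in_auts)
      moreover have "?glue (g, h) (rt_root S) = rt_root S"
        using g roots by (simp add: rooted_iso_def)
      ultimately show ?thesis by simp
    qed
    then show "?glue ` (auts S \<times> auts T) \<subseteq> ?F" by blast
  qed
  then have "card ?F = card (auts S \<times> auts T)"
    by (rule bij_betw_same_card)
  then show ?thesis
    by (simp add: card_cartesian_product aut_order_eq)
qed

text \<open>An automorphism moving the root of \<open>S\<close> must send it to the root of
  \<open>T\<close>, and would then restrict to an isomorphism from \<open>S\<close> to
  \<open>T\<close>.\<close>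

lemma aut_order_join_not_isomorphic:
  assumes "\<not> rooted_isomorphic S T"
  shows "aut_order (join_trees r S T) = aut_order S * aut_order T"
proof -
  have "f (rt_root S) = rt_root S" if "f \<in> auts (join_trees r S T)" for f
  proof -
    have f: "rooted_iso (join_trees r S T) (join_trees r S T) f"
      using that by (simp add: auts_def)
    have "f (rt_root S) \<noteq> rt_root T"
    proof
      assume "f (rt_root S) = rt_root T"
      then have "rooted_iso S T f"
        \<comment> \<open>The target is read as \<open>join_trees r T S\<close>, which makes
          \<open>T\<close> the branch corresponding to \<open>S\<close>.\<close>
        using rooted_iso_join_left(1)[OF tree_join_axioms swap, of f] f
        by (simp add: join_trees_commute[of r T S])
      with assms show False by (auto simp: rooted_isomorphic_def)
    qed
    then show ?thesis
      using rooted_iso_join_root[OF tree_join_axioms tree_join_axioms f] by blast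
  qed
  then have "{f \<in> auts (join_trees r S T). f (rt_root S) = rt_root S} = auts (join_trees r S T)"
    by blast
  then show ?thesis
    using card_auts_fixing_branches by (simp add: aut_order_eq)
qed

text \<open>The swap built from \<open>g\<close> and its inverse moves the root of \<open>S\<close>,
  so the automorphisms fixing that root form a proper subset of a finite set.\<close>

lemma aut_order_join_isomorphic:
  assumes "rooted_isomorphic S T"
  shows "aut_order S * aut_order T < aut_order (join_trees r S T)"
proof -
  let ?J = "join_trees r S T"
  obtain g where g: "rooted_iso S T g"
    using assms by (auto simp: rooted_isomorphic_def)
  let ?f = "\<lambda>x. if x \<in> tverts S then g x else
    if x \<in> tverts T then inv_into (tverts S) g x else r"
  have "rooted_iso ?J ?J ?f"
    using rooted_iso_join[OF tree_join_axioms swap g rooted_iso_inv_into[OF g roots(1)]]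
    by (simp add: join_trees_commute[of r T S])
  then have f: "restrict ?f (tverts ?J) \<in> auts ?J"
    by (intro restrict_in_auts) auto
  have "restrict ?f (tverts ?J) (rt_root S) = rt_root T"
    using g roots by (simp add: rooted_iso_def)
  then have "restrict ?f (tverts ?J) \<notin> {f \<in> auts ?J. f (rt_root S) = rt_root S}"
    using root_neq by (simp del: restrict_apply)
  with f have "{f \<in> auts ?J. f (rt_root S) = rt_root S} \<subset> auts ?J"
    by blast
  then have "card {f \<in> auts ?J. f (rt_root S) = rt_root S} < card (auts ?J)"
    using finite_auts rooted_tree_finite[OF rooted_tree_join] by (metis psubset_card_mono)
  then show ?thesis
    by (simp add: card_auts_fixing_branches aut_order_eq)
qed

end

section \<open>Joining arbitrary trees, and the equivalence\<close>

text \<open>Replacing \<open>T\<close> by a disjoint copy affects neither the invariant nor the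
  number of automorphisms, so overlapping trees are covered, in particular \<open>S\<close> joined
  with itself.\<close>

lemma join_exists:
  fixes S T :: "('v::infinite) rooted_graph"
  assumes A: "comm_monoid A" "\<Xi> \<in> carrier A \<rightarrow> carrier A"
    and S: "rooted_tree S" and T: "rooted_tree T"
  obtains J :: "'v rooted_graph" where "rooted_tree J"
    and "tree_invariant A \<Xi> J = \<Xi> (tree_invariant A \<Xi> S \<otimes>\<^bsub>A\<^esub> tree_invariant A \<Xi> T)"
    and "\<not> rooted_isomorphic S T \<Longrightarrow> aut_order J = aut_order S * aut_order T"
    and "rooted_isomorphic S T \<Longrightarrow> aut_order S * aut_order T < aut_order J"
proof -
  obtain T' :: "'v rooted_graph" where T': "rooted_tree T'" "rooted_isomorphic T T'"
    "tverts T' \<inter> tverts S = {}"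
    using disjoint_copy[OF T rooted_tree_finite[OF S]] by blast
  have "finite (tverts S \<union> tverts T')"
    using S T'(1) by (simp add: rooted_tree_finite)
  then obtain r where r: "r \<notin> tverts S \<union> tverts T'"
    using ex_new_if_finite[OF infinite_UNIV] by blast
  interpret tree_join r S T'
    using S T' r by unfold_locales auto
  have iso: "rooted_isomorphic S T \<longleftrightarrow> rooted_isomorphic S T'"
    using T'(2) rooted_isomorphic_trans rooted_isomorphic_sym rooted_tree_root[OF T] by blast
  have aut: "aut_order T' = aut_order T"
    using aut_order_isomorphic[OF T'(2) T T'(1)] by simp
  have inv: "tree_invariant A \<Xi> T' = tree_invariant A \<Xi> T"
    using tree_invariant_isomorphic[OF A T T'(1,2)] by simp
  show ?thesis
    using that[OF rooted_tree_join] tree_invariant_join[OF A] aut_order_join_not_isomorphic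
      aut_order_join_isomorphic iso aut inv by simp
qed

theorem theorem4p3:
  fixes K :: "('k, 'm) ring_scheme"
    and A :: "('k, 'a, 'n) module_scheme"
    and \<Xi> :: "'a \<Rightarrow> 'a"
  assumes "field K"
    and "algebra K A"
    and "linear_endo K A \<Xi>"
  shows "(\<forall>(T1 :: ('v::infinite) rooted_graph) (T2 :: 'v rooted_graph).
            rooted_tree T1 \<longrightarrow> rooted_tree T2 \<longrightarrow>
            (tree_invariant A \<Xi> T1 = tree_invariant A \<Xi> T2 \<longleftrightarrow> rooted_isomorphic T1 T2))
     \<longleftrightarrow>
         (\<forall>(T1 :: 'v rooted_graph) (T2 :: 'v rooted_graph).
            rooted_tree T1 \<longrightarrow> rooted_tree T2 \<longrightarrow>
            aut_order T1 \<noteq> aut_order T2 \<longrightarrow> tree_invariant A \<Xi> T1 \<noteq> tree_invariant A \<Xi> T2)"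
    (is "?distinguishes \<longleftrightarrow> ?finer")
proof
  assume dist: ?distinguishes
  show ?finer
  proof (intro allI impI notI)
    fix S T :: "'v rooted_graph"
    assume S: "rooted_tree S" and T: "rooted_tree T" and "aut_order S \<noteq> aut_order T"
      and "tree_invariant A \<Xi> S = tree_invariant A \<Xi> T"
    \<comment> \<open>Equal invariants would make the trees isomorphic, hence their automorphism
      groups of equal order.\<close>
    then show False
      using dist[rule_format, OF S T] aut_order_isomorphic[OF _ S T] by simp
  qed
next
  assume finer: ?finer
  interpret algebra K A by fact
  have A: "comm_monoid A" by unfold_locales
  have X: "\<Xi> \<in> carrier A \<rightarrow> carrier A"
    using assms(3) by (auto simp: linear_endo_def)
  show ?distinguishes
  proof (intro allI impI iffI)
    fix S T :: "'v rooted_graph"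
    assume S: "rooted_tree S" and T: "rooted_tree T"
    show "tree_invariant A \<Xi> S = tree_invariant A \<Xi> T" if "rooted_isomorphic S T"
      using tree_invariant_isomorphic[OF A X S T that] .
    assume eq: "tree_invariant A \<Xi> S = tree_invariant A \<Xi> T"
    show "rooted_isomorphic S T"
    proof (rule ccontr)
      assume neq: "\<not> rooted_isomorphic S T"
      have aut: "aut_order S = aut_order T"
        using finer[rule_format, OF S T] eq by blast
      have "rooted_isomorphic S S"
        by (auto simp: rooted_isomorphic_def rooted_iso_def bij_betw_def intro!: exI[of _ id])
      then obtain J :: "'v rooted_graph" where J: "rooted_tree J" "aut_order S * aut_order S < aut_order J"
        "tree_invariant A \<Xi> J = \<Xi> (tree_invariant A \<Xi> S \<otimes>\<^bsub>A\<^esub> tree_invariant A \<Xi> S)"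
        using join_exists[OF A X S S] by blast
      obtain J' :: "'v rooted_graph" where J': "rooted_tree J'" "aut_order J' = aut_order S * aut_order T"
        "tree_invariant A \<Xi> J' = \<Xi> (tree_invariant A \<Xi> S \<otimes>\<^bsub>A\<^esub> tree_invariant A \<Xi> T)"
        using neq join_exists[OF A X S T] by blast
      \<comment> \<open>By \<open>eq\<close> the arguments of \<open>\<Xi>\<close> agree for
        \<open>J\<close> and \<open>J'\<close>, hence so do the invariants, and \<open>finer\<close>
        applies to the two joins.\<close>
      have "aut_order J = aut_order J'"
        using finer[rule_format, OF J(1) J'(1)] J(3) J'(3) eq by auto
      then show False
        using J(2) J'(2) aut by simp
    qed
  qed
qed

end
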